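(* Let $X$ be a compact metrizable space and let $\Delta$ be a closed set of Borel probability measures on $X$. Then $(X,\Delta)$ has the small boundary property (SBP) if, and only if, for every continuous function $f\colon X\to\mathbb R$ and every $\varepsilon>0$ there is a continuous function $g\colon X\to\mathbb R$ such that (1) $\|f-g\|_{2,\Delta}<\varepsilon$, and (2) $\mu(g^{-1}(0))<\varepsilon$ for all $\mu\in\Delta$. Moreover, for a continuous $g\colon X\to\mathbb R$, condition (2) is equivalent to the existence of $\delta>0$ such that $\tau_\mu(\chi_\delta(g))<\varepsilon$ for all $\mu\in\Delta$, where $\chi_\delta\colon\mathbb R\to\mathbb R$ is the continuous function equal to $1$ on $\{|t|<\delta/2\}$, equal to $0$ on $\{|t|>\delta\}$, and linear in between.
   Context: "Closed" refers to the weak* topology on Borel probability measures. For a Borel probability measure $\mu$, $\tau_\mu(h)=\int h\,d\mu$ for $h\in \mathrm{C}(X)$. For $f\in \mathrm{C}(X)$, $\|f\|_{2,\Delta}=\sup\{(\int|f|^2d\mu)^{1/2}:\mu\in\Delta\}$. The pair $(X,\Delta)$ has the small boundary property (SBP) if for every $x\in X$ and every open set $U\ni x$ there is an open neighbourhood $V\subseteq U$ of $x$ with $\mu(\partial V)=0$ for all $\mu\in\Delta$ (equivalently: for all closed $V\subseteq$ open $U$ there is a closed $V'$ with $V\subseteq V'\subseteq U$ and $\mu(\partial V')=0$ for all $\mu\in\Delta$). *)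

theory Defs
  imports "HOL-Analysis.Analysis" "HOL-Probability.Probability"
begin

definition borel_probs :: "('a::topological_space) measure set" where
  "borel_probs = {\<mu>. sets \<mu> = sets borel \<and> prob_space \<mu>}"

text \<open>The weak* topology on Borel probability measures: generated by the maps
  \<mu> \<mapsto> \<tau>_\<mu>(h) = integral of h, h continuous. Its topspace is borel_probs.\<close>
definition weak_star_topology :: "('a::topological_space) measure topology" where
  "weak_star_topology = topology_generated_by
     {{\<mu> \<in> borel_probs. (\<integral>x. h x \<partial>\<mu>) \<in> U} | (h :: 'a \<Rightarrow> real) U.
        continuous_on UNIV h \<and> open U}"

text \<open>The norm sup over mu in Delta of (integral |f|^2 d mu)^(1/2); the supremum of the
  empty family is 0.\<close>
definition norm2_Delta :: "('a::topological_space) measure set \<Rightarrow> ('a \<Rightarrow> real) \<Rightarrow> ennreal" where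
  "norm2_Delta \<Delta> f = (\<Squnion>\<mu>\<in>\<Delta>. ennreal (sqrt (\<integral>x. \<bar>f x\<bar>^2 \<partial>\<mu>)))"

definition SBP :: "('a::topological_space) measure set \<Rightarrow> bool" where
  "SBP \<Delta> \<longleftrightarrow> (\<forall>x U. open U \<and> x \<in> U \<longrightarrow>
     (\<exists>V. open V \<and> x \<in> V \<and> V \<subseteq> U \<and> (\<forall>\<mu>\<in>\<Delta>. measure \<mu> (frontier V) = 0)))"

definition chi :: "real \<Rightarrow> real \<Rightarrow> real" where
  "chi \<delta> t = (if \<bar>t\<bar> \<le> \<delta>/2 then 1 else if \<bar>t\<bar> \<ge> \<delta> then 0 else (\<delta> - \<bar>t\<bar>) / (\<delta>/2))"

end

(* Compactness of Delta is needed only sequentially. A Borel map from X into the Cantor set, recording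
   membership in countably many small balls, has a uniformly continuous inverse; pushing measures
   forward along it reduces the extraction of weak* limits to Helly's theorem on the real line.

   A weak* limit of measures mu_n with tau_{mu_n}(chi_{1/n}(g)) \<ge> eps gives the zero set of g mass at
   least eps, which yields the equivalence for condition (2). In particular (2) is an open condition on g for
   the uniform norm. Truncating g to [f - c, f + c] turns an L2-approximation into a uniform one, because
   Chebyshev controls the set where truncation acts. Hence Baire's theorem gives uniform approximants
   whose zero set is null for all of Delta, and the boundary of {g > 0} lies in that zero set.
   Conversely, the SBP gives an open W between {f \<le> 0} and {f < c} with null boundary, and a function
   uniformly close to f that vanishes exactly on the boundary of W. *)

theory Submission
  imports Defs
begin

section \<open>Coding a compact metric space by reals\<close>

text \<open>At the first differing digit \<open>k\<close> the two terms are
  \<open>2 / 3 ^ Suc k\<close> apart, while all later digits together contribute at most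
  \<open>1 / 3 ^ Suc k\<close>. So the sums are at least \<open>1 / 3 ^ Suc k\<close> apart, which
  is at least \<open>1 / 3 ^ N\<close> because \<open>k \<le> n < N\<close>. The gap survives
  because the base is 3 and the digits are weighted by 2, as in the Cantor set.\<close>

lemma ternary_code_separates:
  fixes b c :: "nat \<Rightarrow> real"
  assumes bit: "\<And>n. b n \<in> {0,1}" "\<And>n. c n \<in> {0,1}"
    and less: "\<bar>(\<Sum>n. 2 / 3 ^ Suc n * b n) - (\<Sum>n. 2 / 3 ^ Suc n * c n)\<bar> < 1 / 3 ^ N"
    and "n < N"
  shows "b n = c n"
proof (rule ccontr)
  assume ne: "b n \<noteq> c n"
  define k where "k = (LEAST n. b n \<noteq> c n)"
  have k: "b k \<noteq> c k" "k \<le> n" "\<And>m. m < k \<Longrightarrow> b m = c m"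
    unfolding k_def using ne LeastI[of "\<lambda>n. b n \<noteq> c n" n]
    by (auto intro: Least_le dest: not_less_Least)
  have geo: "summable (\<lambda>n. 2 / 3 ^ Suc n :: real)"
    using summable_mult[OF summable_geometric[of "1/3::real"], of "2/3"] by (simp add: power_divide)
  have bd: "\<bar>b n\<bar> \<le> 1" "\<bar>c n\<bar> \<le> 1" "\<bar>b n - c n\<bar> \<le> 1" for n
    using bit[of n] by auto
  have sb: "summable (\<lambda>n. 2 / 3 ^ Suc n * b n)" and sc: "summable (\<lambda>n. 2 / 3 ^ Suc n * c n)"
    using bd by (auto intro!: summable_comparison_test'[OF geo, of 0] simp: abs_mult divide_simps)
  define d where "d n = 2 / 3 ^ Suc n * (b n - c n)" for n
  have sd: "summable d"
    using summable_diff[OF sb sc] unfolding d_def right_diff_distrib .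
  have eq: "(\<Sum>n. 2 / 3 ^ Suc n * b n) - (\<Sum>n. 2 / 3 ^ Suc n * c n) = suminf d"
    unfolding suminf_diff[OF sb sc] d_def right_diff_distrib ..
  have init: "suminf d = (\<Sum>n. d (n + Suc k)) + d k"
    using suminf_split_initial_segment[OF sd, of "Suc k"] k(3) by (simp add: d_def)
  have geo2: "(\<lambda>n. 2 / 3 ^ Suc (n + Suc k) :: real) sums (1 / 3 ^ Suc k)"
    using sums_mult[OF geometric_sums[of "1/3::real"], of "2 / 3 ^ Suc (Suc k)"]
    by (simp add: power_divide power_add mult_ac field_simps)
  have dle: "norm (d m) \<le> 2 / 3 ^ Suc m" for m
    using mult_left_mono[OF bd(3)[of m], of "2 / 3 ^ Suc m"]
    unfolding d_def real_norm_def abs_mult by simp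
  have "\<bar>\<Sum>n. d (n + Suc k)\<bar> \<le> (\<Sum>n. 2 / 3 ^ Suc (n + Suc k))"
  proof -
    have "norm (\<Sum>n. d (n + Suc k)) \<le> (\<Sum>n. 2 / 3 ^ Suc (n + Suc k))"
      by (intro norm_suminf_le sums_summable[OF geo2] dle)
    then show ?thesis by simp
  qed
  then have tail: "\<bar>\<Sum>n. d (n + Suc k)\<bar> \<le> 1 / 3 ^ Suc k"
    using sums_unique[OF geo2] by simp
  have "\<bar>d k\<bar> = 2 * (1 / 3 ^ Suc k)"
    using k(1) bit[of k] by (auto simp: d_def abs_mult)
  then have "\<bar>suminf d\<bar> \<ge> 1 / 3 ^ Suc k"
    using tail init by linarith
  moreover have "(1::real) / 3 ^ N \<le> 1 / 3 ^ Suc k"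
    using k(2) \<open>n < N\<close> by (intro divide_left_mono power_increasing) auto
  ultimately show False
    using less eq by linarith
qed

text \<open>The sequence enumerates finite covers by balls of radius \<open>1 / Suc m\<close>, one
  cover for each \<open>m\<close>. Two points with the same membership pattern in one whole cover
  share a ball of it, so they are close.\<close>

lemma compact_countable_ball_base:
  assumes "compact (UNIV :: 'a::metric_space set)"
  obtains B :: "nat \<Rightarrow> 'a::metric_space set" where "\<And>n. open (B n)"
    "\<And>e. e > 0 \<Longrightarrow> \<exists>N. \<forall>x y. (\<forall>n<N. x \<in> B n \<longleftrightarrow> y \<in> B n) \<longrightarrow> dist x y < e"
proof -
  have "\<exists>C. finite C \<and> (UNIV::'a set) \<subseteq> (\<Union>c\<in>C. ball c (1 / Suc m))" for m :: nat
  proof -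
    have "UNIV \<subseteq> (\<Union>c\<in>(UNIV::'a set). ball c (1 / Suc m))"
      by auto
    then show ?thesis
      using compactE_image[OF assms, of UNIV "\<lambda>c. ball c (1 / Suc m)"] by (metis open_ball)
  qed
  then obtain C where C: "\<And>m. finite (C m)" "\<And>m. (UNIV::'a set) \<subseteq> (\<Union>c\<in>C m. ball c (1 / Suc m))"
    by metis
  define S where "S = (\<Union>m. (\<lambda>c. ball c (1 / Suc m)) ` C m)"
  have S: "countable S"
    unfolding S_def using C(1) by (auto intro: countable_finite)
  \<comment> \<open>Nonemptiness keeps \<open>from_nat_into S n\<close> inside \<open>S\<close> also
    for indices beyond the range of \<open>to_nat_on S\<close>.\<close>
  have Sne: "S \<noteq> {}"
    using C(2) by (force simp: S_def)
  show thesis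
  proof
    show "open (from_nat_into S n)" for n
      using from_nat_into[OF Sne, of n] by (auto simp: S_def)
    fix e :: real assume "e > 0"
    then obtain m where m: "1 / real (Suc m) < e / 2"
      using nat_approx_posE[of "e/2"] by auto
    \<comment> \<open>Every ball of the \<open>m\<close>-th cover has index below
      \<open>N\<close>.\<close>
    define N where "N = Suc (Max (to_nat_on S ` (\<lambda>c. ball c (1 / Suc m)) ` C m))"
    show "\<exists>N. \<forall>x y. (\<forall>n<N. x \<in> from_nat_into S n \<longleftrightarrow> y \<in> from_nat_into S n) \<longrightarrow> dist x y < e"
    proof (intro exI[of _ N] allI impI)
      fix x y assume *: "\<forall>n<N. x \<in> from_nat_into S n \<longleftrightarrow> y \<in> from_nat_into S n"
      obtain c where c: "c \<in> C m" "x \<in> ball c (1 / Suc m)"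
        using C(2)[of m] by blast
      have inS: "ball c (1 / Suc m) \<in> S"
        using c by (auto simp: S_def)
      have "to_nat_on S (ball c (1 / Suc m)) < N"
        unfolding N_def less_Suc_eq_le using C(1) c(1) by (intro Max_ge) auto
      then have "y \<in> ball c (1 / Suc m)"
        using * c(2) from_nat_into_to_nat_on[OF S inS] by metis
      then have "dist x y < 1 / Suc m + 1 / Suc m"
        using c(2) dist_triangle3[of x y c] by auto
      then show "dist x y < e"
        using m by simp
    qed
  qed
qed

text \<open>The digits of \<open>s x\<close> record membership of \<open>x\<close> in the balls of
  the base. Since these digits jump, \<open>s\<close> is only claimed to be Borel; the gain lies in
  the other direction: close codes share their leading digits, hence come from close points.\<close>

lemma compact_borel_code:
  assumes "compact (UNIV :: 'a::metric_space set)"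
  obtains s :: "'a::metric_space \<Rightarrow> real" where "s \<in> borel_measurable borel" "\<And>x. s x \<in> {0..1}"
    "\<And>e. e > 0 \<Longrightarrow> \<exists>d>0. \<forall>x y. dist (s x) (s y) < d \<longrightarrow> dist x y < e"
proof -
  obtain B :: "nat \<Rightarrow> 'a set" where B: "\<And>n. open (B n)"
    "\<And>e. e > 0 \<Longrightarrow> \<exists>N. \<forall>x y. (\<forall>n<N. x \<in> B n \<longleftrightarrow> y \<in> B n) \<longrightarrow> dist x y < e"
    using compact_countable_ball_base[OF assms] by metis
  define s :: "'a \<Rightarrow> real" where "s x = (\<Sum>n. 2 / 3 ^ Suc n * indicator (B n) x)" for x
  have geo: "(\<lambda>n. 2 / 3 ^ Suc n :: real) sums 1"
    using sums_mult[OF geometric_sums[of "1/3::real"], of "2/3"] by (simp add: power_divide)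
  have ssum: "summable (\<lambda>n. 2 / 3 ^ Suc n * indicator (B n) x :: real)" for x
    by (rule summable_comparison_test'[OF sums_summable[OF geo], of 0]) (auto simp: indicator_def)
  have [measurable]: "B n \<in> sets borel" for n
    using B(1) by auto
  show thesis
  proof
    show "s \<in> borel_measurable borel"
      unfolding s_def[abs_def] by measurable
    have "s x \<le> (\<Sum>n. 2 / 3 ^ Suc n)" for x
      unfolding s_def by (intro suminf_le ssum sums_summable[OF geo]) (auto simp: indicator_def)
    then show "s x \<in> {0..1}" for x
      using suminf_nonneg[OF ssum, of x] sums_unique[OF geo] by (auto simp: s_def)
    fix e :: real assume "e > 0"
    then obtain N where N: "\<And>x y. (\<And>n. n < N \<Longrightarrow> x \<in> B n \<longleftrightarrow> y \<in> B n) \<Longrightarrow> dist x y < e"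
      using B(2) by metis
    show "\<exists>d>0. \<forall>x y. dist (s x) (s y) < d \<longrightarrow> dist x y < e"
    proof (intro exI[of _ "1 / 3 ^ N"] conjI allI impI)
      fix x y assume *: "dist (s x) (s y) < 1 / 3 ^ N"
      show "dist x y < e"
      proof (rule N)
        fix n assume "n < N"
        have "(indicator (B n) x :: real) = indicator (B n) y"
          using * \<open>n < N\<close>
          by (intro ternary_code_separates[where b="\<lambda>n. indicator (B n) x" and c="\<lambda>n. indicator (B n) y" and N=N])
             (auto simp: s_def dist_real_def indicator_def)
        then show "x \<in> B n \<longleftrightarrow> y \<in> B n"
          by (auto simp: indicator_def split: if_splits)
      qed
    qed auto
  qed
qed

text \<open>The hypothesis \<open>code\<close> says that \<open>s\<close> is injective with
  uniformly continuous inverse on its range. The extension to the closure of the range is read off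
  from the closure of the graph.\<close>

lemma continuous_extension_of_inverse:
  fixes s :: "'a::metric_space \<Rightarrow> 'b::metric_space"
  assumes "compact (UNIV :: 'a set)"
    and code: "\<And>e. e > 0 \<Longrightarrow> \<exists>d>0. \<forall>x y. dist (s x) (s y) < d \<longrightarrow> dist x y < e"
  obtains p where "continuous_on (closure (range s)) p" "\<And>x. p (s x) = x"
proof -
  define G where "G = closure (range (\<lambda>x. (s x, x)))"
  \<comment> \<open>Compactness of the domain supplies a limit point over each \<open>y\<close> in
    the closure.\<close>
  have ex: "\<exists>x. (y, x) \<in> G" if y: "y \<in> closure (range s)" for y
  proof -
    obtain u where u: "\<And>n. u n \<in> range s" "u \<longlonglongrightarrow> y"
      using y unfolding closure_sequential by metis
    define v where "v n = inv s (u n)" for n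
    have v: "u n = s (v n)" for n
      using f_inv_into_f[OF u(1)] by (simp add: v_def)
    obtain l r where r: "strict_mono (r :: nat \<Rightarrow> nat)" "(v \<circ> r) \<longlonglongrightarrow> l"
      using seq_compactE[OF compact_imp_seq_compact[OF assms(1)], of v] by (metis UNIV_I)
    have "(\<lambda>n. (s (v (r n)), v (r n))) \<longlonglongrightarrow> (y, l)"
      using LIMSEQ_subseq_LIMSEQ[OF u(2) r(1)] r(2) by (intro tendsto_Pair) (auto simp: o_def v)
    then show ?thesis
      unfolding G_def closure_sequential
      by (intro exI[of _ l] exI[of _ "\<lambda>n. (s (v (r n)), v (r n))"] conjI) auto
  qed
  have app: "\<exists>a. dist (s a, a) z < \<delta>" if z: "z \<in> G" "\<delta> > 0" for z \<delta>
  proof -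
    have "\<exists>w\<in>range (\<lambda>x. (s x, x)). dist w z < \<delta>"
      using z(1)[unfolded G_def closure_approachable] z(2) by simp
    then show ?thesis by blast
  qed
  \<comment> \<open>The estimate \<open>code\<close> passes from the graph to its closure, with
    thirds of \<open>d\<close> and \<open>e\<close> spent on approximating both points. It gives
    continuity of any selection from \<open>G\<close> and, at \<open>y = y'\<close>, its
    uniqueness.\<close>
  have uc: "\<exists>d>0. \<forall>y x y' x'. (y, x) \<in> G \<and> (y', x') \<in> G \<and> dist y y' < d \<longrightarrow> dist x x' < e"
    if "e > 0" for e
  proof -
    obtain d where d: "d > 0" "\<And>x y. dist (s x) (s y) < d \<Longrightarrow> dist x y < e/3"
      using code[of "e/3"] \<open>e > 0\<close> by auto
    have "dist x x' < e" if G: "(y, x) \<in> G" "(y', x') \<in> G" and yy: "dist y y' < d/3" for y x y' x'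
    proof -
      have pos: "min (d/3) (e/3) > 0"
        using d(1) \<open>e > 0\<close> by simp
      obtain a where a: "dist (s a, a) (y, x) < min (d/3) (e/3)"
        using app[OF G(1) pos] by metis
      obtain a' where a': "dist (s a', a') (y', x') < min (d/3) (e/3)"
        using app[OF G(2) pos] by metis
      have 1: "dist (s a) y < d/3" "dist a x < e/3" "dist (s a') y' < d/3" "dist a' x' < e/3"
        using a a' dist_fst_le[of "(s a, a)" "(y, x)"] dist_snd_le[of "(s a, a)" "(y, x)"]
          dist_fst_le[of "(s a', a')" "(y', x')"] dist_snd_le[of "(s a', a')" "(y', x')"] by auto
      have "dist (s a) (s a') \<le> dist (s a) y + dist y y' + dist (s a') y'"
        using dist_triangle[of "s a" "s a'" y] dist_triangle[of y "s a'" y'] by (simp add: dist_commute)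
      then have "dist a a' < e/3"
        using 1 yy by (intro d(2)) simp
      moreover have "dist x x' \<le> dist a x + dist a a' + dist a' x'"
        using dist_triangle[of x x' a] dist_triangle[of a x' a'] by (simp add: dist_commute)
      ultimately show ?thesis
        using 1 by simp
    qed
    then show ?thesis
      using d(1) by (intro exI[of _ "d/3"]) auto
  qed
  define p where "p y = (SOME x. (y, x) \<in> G)" for y
  have p: "(y, p y) \<in> G" if "y \<in> closure (range s)" for y
    unfolding p_def using ex[OF that] by (rule someI_ex)
  show thesis
  proof
    show "continuous_on (closure (range s)) p"
      unfolding continuous_on_iff
    proof (intro ballI allI impI)
      fix y and e :: real assume y: "y \<in> closure (range s)" and "e > 0"
      from uc[OF \<open>e > 0\<close>] obtain d where "d > 0"
        "\<And>y x y' x'. (y, x) \<in> G \<Longrightarrow> (y', x') \<in> G \<Longrightarrow> dist y y' < d \<Longrightarrow> dist x x' < e"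
        by metis
      then show "\<exists>d>0. \<forall>x'\<in>closure (range s). dist x' y < d \<longrightarrow> dist (p x') (p y) < e"
        using p y by metis
    qed
    fix x
    have "(s x, x) \<in> G"
      unfolding G_def by (intro subsetD[OF closure_subset] rangeI)
    moreover have "(s x, p (s x)) \<in> G"
      by (intro p subsetD[OF closure_subset] rangeI)
    \<comment> \<open>Both \<open>x\<close> and \<open>p (s x)\<close> lie over \<open>s x\<close>
      in \<open>G\<close>, so \<open>uc\<close> applies at distance 0.\<close>
    ultimately have "dist (p (s x)) x < e" if "e > 0" for e
      using uc[OF that] by (metis dist_self)
    from this[of "dist (p (s x)) x"] show "p (s x) = x"
      by auto
  qed
qed

section \<open>Weak* sequential compactness\<close>

lemma borel_probsD:
  assumes "\<mu> \<in> borel_probs"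
  shows "sets \<mu> = sets borel" "prob_space \<mu>" "space \<mu> = UNIV"
  using assms sets_eq_imp_space_eq[of \<mu> borel] by (auto simp: borel_probs_def)

lemma continuous_bounded_on_compact_UNIV:
  fixes h :: "'a::topological_space \<Rightarrow> real"
  assumes "compact (UNIV :: 'a set)" "continuous_on UNIV h"
  obtains B where "B \<ge> 0" "\<And>x. \<bar>h x\<bar> \<le> B"
proof -
  obtain B where B: "\<And>x. \<bar>h x\<bar> \<le> B"
    using compact_imp_bounded[OF compact_continuous_image[OF assms(2,1)]]
    by (auto simp: bounded_iff)
  show thesis
    by (rule that[OF _ B]) (use B[of undefined] in linarith)
qed

lemma continuous_integrable:
  fixes h :: "'a::topological_space \<Rightarrow> real"
  assumes "compact (UNIV :: 'a set)" "\<mu> \<in> borel_probs" "continuous_on UNIV h"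
  shows "integrable \<mu> h"
proof -
  interpret prob_space \<mu> using borel_probsD[OF assms(2)] by simp
  obtain B where "\<And>x. \<bar>h x\<bar> \<le> B"
    using continuous_bounded_on_compact_UNIV[OF assms(1,3)] by metis
  moreover have "h \<in> borel_measurable \<mu>"
    using borel_measurable_continuous_onI[OF assms(3)]
    unfolding measurable_cong_sets[OF borel_probsD(1)[OF assms(2)] refl] .
  ultimately show ?thesis
    by (intro integrable_const_bound[of _ B]) auto
qed

lemma tight_of_support_interval:
  assumes "\<And>n. real_distribution (M n)" "\<And>n. measure (M n) {0..1} = 1"
  shows "tight M"
  unfolding tight_def
proof (intro conjI allI impI assms(1))
  fix e :: real assume "e > 0"
  \<comment> \<open>Tightness is phrased with half-open intervals, so the left end moves to -1 in
    order to keep the point 0.\<close>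
  have "1 - e < measure (M n) {-1<..1}" for n
  proof -
    interpret real_distribution "M n" by fact
    have "measure (M n) {0..1} \<le> measure (M n) {-1<..1}"
      by (intro finite_measure_mono) auto
    then show ?thesis using assms(2)[of n] \<open>e > 0\<close> by simp
  qed
  then show "\<exists>a b. a < b \<and> (\<forall>n. 1 - e < measure (M n) {a<..b})"
    by (intro exI[of _ "-1"] exI[of _ 1]) auto
qed

text \<open>The laws of \<open>s\<close> under \<open>M n\<close> live on \<open>[0,1]\<close>, so a
  subsequence converges weakly to some \<open>N\<close>. This limit is carried by the closure
  \<open>K\<close> of the range of \<open>s\<close>, where the inverse of \<open>s\<close> extends
  continuously; its image under that extension is the limit measure.\<close>

lemma borel_probs_seq_compact:
  fixes M :: "nat \<Rightarrow> ('a::metric_space) measure"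
  assumes comp: "compact (UNIV :: 'a set)" and M: "\<And>n. M n \<in> borel_probs"
  obtains r \<mu> where "strict_mono (r :: nat \<Rightarrow> nat)" "\<mu> \<in> borel_probs"
    "\<And>h :: 'a \<Rightarrow> real. continuous_on UNIV h \<Longrightarrow> (\<lambda>n. \<integral>x. h x \<partial>M (r n)) \<longlonglongrightarrow> (\<integral>x. h x \<partial>\<mu>)"
proof -
  obtain s :: "'a \<Rightarrow> real" where s[measurable]: "s \<in> borel_measurable borel" and s01: "\<And>x. s x \<in> {0..1}"
    and code: "\<And>e. e > 0 \<Longrightarrow> \<exists>d>0. \<forall>x y. dist (s x) (s y) < d \<longrightarrow> dist x y < e"
    using compact_borel_code[OF comp] by metis
  define K where "K = closure (range s)"
  obtain p where p: "continuous_on K p" "\<And>x. p (s x) = x"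
    using continuous_extension_of_inverse[OF comp code] unfolding K_def by metis
  have sK: "s x \<in> K" for x
    unfolding K_def using closure_subset by fastforce
  have Kne: "K \<noteq> {}" "closed K" using sK by (auto simp: K_def)
  have sM: "s \<in> measurable (M n) borel" for n
    using s unfolding measurable_cong_sets[OF borel_probsD(1)[OF M[of n]] refl] .
  define L where "L n = distr (M n) borel s" for n
  have L: "real_distribution (L n)" for n
    unfolding L_def real_distribution_def real_distribution_axioms_def
    using prob_space.prob_space_distr[OF borel_probsD(2)[OF M] sM] by simp
  have "measure (L n) {0..1} = 1" for n
  proof -
    have "measure (L n) {0..1} = measure (M n) (space (M n))"
      unfolding L_def using sM[of n] s01 by (subst measure_distr) (auto intro!: arg_cong2[where f=measure])
    then show ?thesis
      using prob_space.prob_space[OF borel_probsD(2)[OF M]] by simp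
  qed
  then have "tight L"
    using L by (intro tight_of_support_interval)
  \<comment> \<open>This is Helly's selection theorem, started from the whole sequence by taking
    \<open>id\<close> as the given subsequence.\<close>
  then obtain r N where r: "strict_mono (r :: nat \<Rightarrow> nat)" and N: "real_distribution N"
    and "weak_conv_m (L \<circ> id \<circ> r) N"
    using tight_imp_convergent_subsubsequence[of L id] by (auto simp: strict_mono_def)
  then have wc: "weak_conv_m (L \<circ> r) N" by simp
  interpret N: real_distribution N by fact
  have conv: "(\<lambda>n. \<integral>x. H (s x) \<partial>M (r n)) \<longlonglongrightarrow> (\<integral>y. H y \<partial>N)"
    if H: "continuous_on UNIV H" "\<And>y. \<bar>H y\<bar> \<le> C" for H :: "real \<Rightarrow> real" and C
  proof -
    have Hm: "H \<in> borel_measurable borel"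
      using H(1) by (rule borel_measurable_continuous_onI)
    have "(\<lambda>n. \<integral>y. H y \<partial>(L \<circ> r) n) \<longlonglongrightarrow> (\<integral>y. H y \<partial>N)"
      by (rule weak_conv_imp_integral_bdd_continuous_conv[OF _ N wc, where B=C])
         (use L H in \<open>auto simp: continuous_on_eq_continuous_at\<close>)
    then show ?thesis
      using Hm sM by (simp add: L_def integral_distr)
  qed
  \<comment> \<open>The truncated distance to \<open>K\<close> is a bounded continuous test function
    that vanishes at every \<open>s x\<close>, so its integral against \<open>N\<close> is a limit
    of zeros.\<close>
  have AEK: "AE y in N. y \<in> K"
  proof -
    let ?H = "\<lambda>y. min 1 (infdist y K)"
    have contH: "continuous_on UNIV ?H"
      by (intro continuous_intros)
    have "infdist (s x) K = 0" for x
      using sK by simp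
    then have "(\<lambda>n::nat. 0) \<longlonglongrightarrow> (\<integral>y. ?H y \<partial>N)"
      using conv[OF contH, of 1] by (simp add: infdist_nonneg)
    then have 0: "(\<integral>y. ?H y \<partial>N) = 0"
      using LIMSEQ_unique tendsto_const by blast
    have [measurable]: "?H \<in> borel_measurable borel"
      using contH by (rule borel_measurable_continuous_onI)
    have "integrable N ?H"
      by (intro N.integrable_const_bound[of _ 1]) (auto simp: infdist_nonneg)
    then have "AE y in N. ?H y = 0"
      using 0 by (subst (asm) integral_nonneg_eq_0_iff_AE) (auto simp: infdist_nonneg)
    then show ?thesis
      by eventually_elim (use Kne in \<open>auto simp: min_def in_closed_iff_infdist_zero split: if_splits\<close>)
  qed
  \<comment> \<open>\<open>N\<close> may charge points of \<open>K\<close> outside the range of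
    \<open>s\<close>, which is why \<open>p\<close> had to be extended to the closure. Off
    \<open>K\<close> the value is irrelevant, as that set is \<open>N\<close>-null.\<close>
  define q where "q y = (if y \<in> K then p y else undefined)" for y
  have q[measurable]: "q \<in> borel_measurable borel"
    unfolding q_def using Kne p(1)
    by (intro borel_measurable_continuous_on_if) auto
  have qN: "q \<in> measurable N borel" 
    using q unfolding measurable_cong_sets[OF N.events_eq_borel refl] .
  define \<mu> where "\<mu> = distr N borel q"
  show thesis
  proof
    show "strict_mono r" by fact
    show "\<mu> \<in> borel_probs"
      using N.prob_space_distr[OF qN] by (simp add: borel_probs_def \<mu>_def)
    fix h :: "'a \<Rightarrow> real" assume h: "continuous_on UNIV h"
    obtain B where B: "B \<ge> 0" "\<And>x. \<bar>h x\<bar> \<le> B"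
      using continuous_bounded_on_compact_UNIV[OF comp h] by metis
    have hp: "continuous_on K (h \<circ> p)"
      by (intro continuous_on_compose p(1) continuous_on_subset[OF h]) auto
    \<comment> \<open>Weak convergence on the line needs bounded continuous test functions on all of
      it, so Tietze extends \<open>h \<circ> p\<close> from \<open>K\<close> with the same
      bound.\<close>
    obtain H where H: "continuous_on UNIV H" "\<And>y. y \<in> K \<Longrightarrow> H y = h (p y)" "\<And>y. \<bar>H y\<bar> \<le> B"
      using Tietze[OF hp, of UNIV B] B Kne by auto
    have hm: "h \<in> borel_measurable borel"
      using h by (rule borel_measurable_continuous_onI)
    have "(\<integral>x. h x \<partial>\<mu>) = (\<integral>y. h (q y) \<partial>N)"
      unfolding \<mu>_def using qN hm by (rule integral_distr)
    also have "\<dots> = (\<integral>y. H y \<partial>N)"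
    proof (rule integral_cong_AE)
      show "AE y in N. h (q y) = H y"
        using AEK by eventually_elim (simp add: q_def H)
    qed (use measurable_compose[OF qN hm] borel_measurable_continuous_onI[OF H(1)] in auto)
    finally show "(\<lambda>n. \<integral>x. h x \<partial>M (r n)) \<longlonglongrightarrow> (\<integral>x. h x \<partial>\<mu>)"
      using conv[OF H(1,3)] H(2)[OF sK] p(2) by simp
  qed
qed

section \<open>Weak* closed sets and convergent sequences\<close>

lemma topspace_weak_star:
  "topspace weak_star_topology = (borel_probs :: 'a::topological_space measure set)"
proof -
  let ?S = "{{\<mu> \<in> borel_probs. (\<integral>x. h x \<partial>\<mu>) \<in> U} | (h :: 'a \<Rightarrow> real) U.
        continuous_on UNIV h \<and> open U}"
  \<comment> \<open>The whole space is itself subbasic: take \<open>h = 0\<close> and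
    \<open>U = UNIV\<close>.\<close>
  have "borel_probs \<in> ?S"
    by (intro CollectI exI[of _ "\<lambda>_. 0"] exI[of _ UNIV]) auto
  moreover have "W \<subseteq> borel_probs" if "W \<in> ?S" for W
    using that by auto
  ultimately have "\<Union>?S = borel_probs"
    by blast
  then show ?thesis
    unfolding weak_star_topology_def topology_generated_by_topspace .
qed

text \<open>Were \<mu> outside \<Delta>, the complement of \<Delta> would be an open neighbourhood
  of \<mu>. Induction over the generation of open sets shows that convergence of all integrals puts
  the sequence eventually into every open neighbourhood of \<mu>.\<close>

lemma weak_star_closed_imp_seq_closed:
  fixes \<Delta> :: "('a::topological_space) measure set"
  assumes cl: "closedin weak_star_topology \<Delta>"
    and M: "\<And>n. M n \<in> \<Delta>" and \<mu>: "\<mu> \<in> borel_probs"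
    and lim: "\<And>h :: 'a \<Rightarrow> real. continuous_on UNIV h \<Longrightarrow> (\<lambda>n. \<integral>x. h x \<partial>M n) \<longlonglongrightarrow> (\<integral>x. h x \<partial>\<mu>)"
  shows "\<mu> \<in> \<Delta>"
proof (rule ccontr)
  assume "\<mu> \<notin> \<Delta>"
  let ?S = "{{\<mu> \<in> borel_probs. (\<integral>x. h x \<partial>\<mu>) \<in> U} | (h :: 'a \<Rightarrow> real) U.
        continuous_on UNIV h \<and> open U}"
  have Mb: "M n \<in> borel_probs" for n
    using M closedin_subset[OF cl] topspace_weak_star by blast
  have "openin weak_star_topology (borel_probs - \<Delta>)"
    using cl by (simp add: closedin_def topspace_weak_star)
  then have "generate_topology_on ?S (borel_probs - \<Delta>)"
    unfolding weak_star_topology_def by (rule openin_topology_generated_by)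
  moreover have "\<mu> \<in> W \<Longrightarrow> eventually (\<lambda>n. M n \<in> W) sequentially"
    if "generate_topology_on ?S W" for W
    using that
  proof induction
    case (Int a b) then show ?case by (auto intro: eventually_conj)
  next
    case (UN k) then show ?case by (auto elim!: eventually_mono) (metis (mono_tags, lifting) eventually_mono)
  next
    case (Basis W)
    then obtain h :: "'a \<Rightarrow> real" and U where "W = {\<mu> \<in> borel_probs. (\<integral>x. h x \<partial>\<mu>) \<in> U}"
      "continuous_on UNIV h" "open U" by blast
    then show ?case
      using Basis lim[of h] Mb topological_tendstoD[of "\<lambda>n. \<integral>x. h x \<partial>M n" "\<integral>x. h x \<partial>\<mu>" sequentially U] by auto
  qed simp
  ultimately have "eventually (\<lambda>n. M n \<in> borel_probs - \<Delta>) sequentially"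
    using \<mu> \<open>\<mu> \<notin> \<Delta>\<close> by blast
  then show False
    using M by (auto simp: eventually_sequentially)
qed

section \<open>Zero sets and cutoffs\<close>

text \<open>A single truncated formula makes the range, continuity and monotonicity in \<delta>
  immediate.\<close>

lemma chi_eq_clamp: "\<delta> > 0 \<Longrightarrow> chi \<delta> t = max 0 (min 1 (2 - 2 * \<bar>t\<bar> / \<delta>))"
  by (auto simp: chi_def min_def max_def field_simps)

lemma chi_eq_0: "\<delta> > 0 \<Longrightarrow> \<delta> \<le> \<bar>t\<bar> \<Longrightarrow> chi \<delta> t = 0"
  by (auto simp: chi_def)

lemma chi_range: "\<delta> > 0 \<Longrightarrow> 0 \<le> chi \<delta> t" "\<delta> > 0 \<Longrightarrow> chi \<delta> t \<le> 1"
  by (auto simp: chi_eq_clamp)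

lemma chi_mono:
  assumes "0 < \<delta>" "\<delta> \<le> \<delta>'"
  shows "chi \<delta> t \<le> chi \<delta>' t"
proof -
  have "2 * \<bar>t\<bar> / \<delta>' \<le> 2 * \<bar>t\<bar> / \<delta>"
    using assms by (intro divide_left_mono) auto
  then show ?thesis
    using assms by (simp add: chi_eq_clamp)
qed

lemma continuous_on_chi:
  assumes "\<delta> > 0" "continuous_on S g"
  shows "continuous_on S (\<lambda>x. chi \<delta> (g x))"
  unfolding chi_eq_clamp[OF assms(1)] using assms by (intro continuous_intros) auto

lemma chi_tendsto_indicator: "(\<lambda>m. chi (1 / Suc m) t) \<longlonglongrightarrow> indicator {0} t"
proof (cases "t = 0")
  case True
  then show ?thesis by (simp add: chi_def)
next
  case False
  then obtain N where N: "1 / real (Suc N) < \<bar>t\<bar>"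
    using nat_approx_posE[of "\<bar>t\<bar>"] by auto
  have "chi (1 / Suc m) t = 0" if "m \<ge> N" for m
  proof -
    have "1 / real (Suc m) \<le> 1 / real (Suc N)"
      using that by (intro divide_left_mono) auto
    then have "\<bar>t\<bar> \<ge> 1 / real (Suc m)"
      using N by linarith
    then show ?thesis
      by (intro chi_eq_0) auto
  qed
  then have "eventually (\<lambda>m. chi (1 / Suc m) t = 0) sequentially"
    by (auto simp: eventually_sequentially)
  then show ?thesis
    using False by (simp add: tendsto_eventually)
qed

lemma zero_set_measurable:
  assumes "\<mu> \<in> borel_probs" "continuous_on UNIV (g :: 'a::topological_space \<Rightarrow> real)"
  shows "g -` {0} \<in> sets \<mu>"
  using borel_probsD(1)[OF assms(1)] continuous_on_closed_vimage[of UNIV g] assms(2)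
  by (auto intro!: borel_closed)

text \<open>On \<open>A\<close> the cutoff equals 1. A general set \<open>A\<close> is allowed so
  that the bound also serves for zero sets of functions uniformly within \<open>\<delta> / 2\<close>
  of \<open>g\<close>.\<close>

lemma measure_le_integral_chi:
  fixes g :: "'a::topological_space \<Rightarrow> real"
  assumes "compact (UNIV :: 'a set)" "\<mu> \<in> borel_probs" "continuous_on UNIV g" "\<delta> > 0"
    and A: "A \<in> sets \<mu>" "\<And>x. x \<in> A \<Longrightarrow> \<bar>g x\<bar> \<le> \<delta> / 2"
  shows "measure \<mu> A \<le> (\<integral>x. chi \<delta> (g x) \<partial>\<mu>)"
proof -
  interpret prob_space \<mu> using borel_probsD[OF assms(2)] by simp
  have "(\<integral>x. indicator A x \<partial>\<mu>) \<le> (\<integral>x. chi \<delta> (g x) \<partial>\<mu>)"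
  proof (rule integral_mono)
    show "integrable \<mu> (indicator A :: 'a \<Rightarrow> real)"
      using A(1) by (simp add: emeasure_eq_measure)
    show "integrable \<mu> (\<lambda>x. chi \<delta> (g x))"
      using assms by (intro continuous_integrable continuous_on_chi)
    show "indicator A x \<le> chi \<delta> (g x)" for x
      using A(2)[of x] chi_range(1)[OF \<open>\<delta> > 0\<close>] by (auto simp: indicator_def chi_def)
  qed
  then show ?thesis
    using A(1) borel_probsD(3)[OF assms(2)] by simp
qed

text \<open>From right to left the cutoff dominates the indicator of the zero set. From left to
  right, failure for every \<delta> gives measures in \<Delta> whose weak* limit charges the zero
  set by at least \<epsilon>.\<close>

lemma zero_sets_small_iff_chi:
  fixes \<Delta> :: "('a::metric_space) measure set"
  assumes comp: "compact (UNIV :: 'a set)"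
    and cl: "closedin weak_star_topology \<Delta>"
    and g: "continuous_on UNIV (g :: 'a \<Rightarrow> real)"
  shows "(\<forall>\<mu>\<in>\<Delta>. measure \<mu> (g -` {0}) < \<epsilon>) \<longleftrightarrow> (\<exists>\<delta>>0. \<forall>\<mu>\<in>\<Delta>. (\<integral>x. chi \<delta> (g x) \<partial>\<mu>) < \<epsilon>)"
proof
  have \<Delta>: "\<mu> \<in> borel_probs" if "\<mu> \<in> \<Delta>" for \<mu>
    using that closedin_subset[OF cl] topspace_weak_star by blast
  show "\<forall>\<mu>\<in>\<Delta>. measure \<mu> (g -` {0}) < \<epsilon>" if chi: "\<exists>\<delta>>0. \<forall>\<mu>\<in>\<Delta>. (\<integral>x. chi \<delta> (g x) \<partial>\<mu>) < \<epsilon>"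
  proof
    fix \<mu> assume "\<mu> \<in> \<Delta>"
    obtain \<delta> where "\<delta> > 0" "(\<integral>x. chi \<delta> (g x) \<partial>\<mu>) < \<epsilon>"
      using chi \<open>\<mu> \<in> \<Delta>\<close> by blast
    moreover have "measure \<mu> (g -` {0}) \<le> (\<integral>x. chi \<delta> (g x) \<partial>\<mu>)"
      using \<open>\<delta> > 0\<close> by (intro measure_le_integral_chi[OF comp \<Delta>[OF \<open>\<mu> \<in> \<Delta>\<close>] g]
          zero_set_measurable[OF \<Delta>[OF \<open>\<mu> \<in> \<Delta>\<close>] g]) auto
    ultimately show "measure \<mu> (g -` {0}) < \<epsilon>" by simp
  qed
  show "\<exists>\<delta>>0. \<forall>\<mu>\<in>\<Delta>. (\<integral>x. chi \<delta> (g x) \<partial>\<mu>) < \<epsilon>" if small: "\<forall>\<mu>\<in>\<Delta>. measure \<mu> (g -` {0}) < \<epsilon>"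
  proof (rule ccontr)
    assume no: "\<not> (\<exists>\<delta>>0. \<forall>\<mu>\<in>\<Delta>. (\<integral>x. chi \<delta> (g x) \<partial>\<mu>) < \<epsilon>)"
    have "\<exists>\<mu>\<in>\<Delta>. (\<integral>x. chi (1 / Suc n) (g x) \<partial>\<mu>) \<ge> \<epsilon>" for n
      using no by (metis not_le of_nat_0_less_iff zero_less_Suc zero_less_divide_1_iff)
    then obtain M where M: "\<And>n. M n \<in> \<Delta>" "\<And>n. (\<integral>x. chi (1 / Suc n) (g x) \<partial>M n) \<ge> \<epsilon>"
      by metis
    obtain r \<mu> where r: "strict_mono (r :: nat \<Rightarrow> nat)" and \<mu>: "\<mu> \<in> borel_probs"
      and lim: "\<And>h :: 'a \<Rightarrow> real. continuous_on UNIV h \<Longrightarrow> (\<lambda>n. \<integral>x. h x \<partial>M (r n)) \<longlonglongrightarrow> (\<integral>x. h x \<partial>\<mu>)"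
      using borel_probs_seq_compact[OF comp, of M] \<Delta>[OF M(1)] by metis
    have "\<mu> \<in> \<Delta>"
      by (rule weak_star_closed_imp_seq_closed[OF cl, of "\<lambda>n. M (r n)", OF M(1) \<mu> lim])
    have ge: "(\<integral>x. chi (1 / Suc m) (g x) \<partial>\<mu>) \<ge> \<epsilon>" for m
    proof (rule tendsto_lowerbound[OF lim])
      show "continuous_on UNIV (\<lambda>x. chi (1 / Suc m) (g x))"
        using g by (intro continuous_on_chi) auto
      have "\<epsilon> \<le> (\<integral>x. chi (1 / Suc m) (g x) \<partial>M (r n))" if "n \<ge> m" for n
      proof -
        have "m \<le> r n"
          using that seq_suble[OF r, of n] by simp
        then have "1 / real (Suc (r n)) \<le> 1 / real (Suc m)"
          by (intro divide_left_mono) auto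
        then have "(\<integral>x. chi (1 / Suc (r n)) (g x) \<partial>M (r n)) \<le> (\<integral>x. chi (1 / Suc m) (g x) \<partial>M (r n))"
          by (intro integral_mono continuous_integrable[OF comp \<Delta>[OF M(1)]] continuous_on_chi g chi_mono) auto
        then show ?thesis
          using M(2)[of "r n"] by linarith
      qed
      then show "\<forall>\<^sub>F n in sequentially. \<epsilon> \<le> (\<integral>x. chi (1 / Suc m) (g x) \<partial>M (r n))"
        by (auto simp: eventually_sequentially)
    qed simp
    interpret prob_space \<mu> using borel_probsD[OF \<mu>] by simp
    have [measurable]: "g -` {0} \<in> sets \<mu>"
      using \<mu> g by (rule zero_set_measurable)
    have "(\<lambda>m. \<integral>x. chi (1 / Suc m) (g x) \<partial>\<mu>) \<longlonglongrightarrow> (\<integral>x. indicator (g -` {0}) x \<partial>\<mu>)"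
    proof (rule integral_dominated_convergence[where w="\<lambda>_. 1"])
      show "(\<lambda>x. chi (1 / Suc m) (g x)) \<in> borel_measurable \<mu>" for m
        using continuous_integrable[OF comp \<mu> continuous_on_chi[OF _ g, of "1 / Suc m"]] by auto
      show "AE x in \<mu>. (\<lambda>m. chi (1 / Suc m) (g x)) \<longlonglongrightarrow> indicator (g -` {0}) x"
        using chi_tendsto_indicator[of "g _"] by (auto simp: indicator_def)
      show "AE x in \<mu>. norm (chi (1 / Suc m) (g x)) \<le> 1" for m
        using chi_range[of "1 / Suc m"] by auto
    qed auto
    then have "\<epsilon> \<le> (\<integral>x. indicator (g -` {0}) x \<partial>\<mu>)"
      by (rule tendsto_lowerbound) (use ge in auto)
    then have "\<epsilon> \<le> measure \<mu> (g -` {0})"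
      using borel_probsD(3)[OF \<mu>] by simp
    then show False
      using small \<open>\<mu> \<in> \<Delta>\<close> by force
  qed
qed

section \<open>The small boundary property and approximation\<close>

text \<open>The empty set is treated separately because \<open>infdist\<close> to it is 0 by
  convention, which would make every point a zero.\<close>

lemma distance_cutoff:
  fixes S :: "'a::metric_space set"
  obtains D :: "'a::metric_space \<Rightarrow> real" where "continuous_on UNIV D" "\<And>x. 0 \<le> D x" "\<And>x. D x \<le> 1"
    "\<And>x. D x = 0 \<longleftrightarrow> x \<in> closure S"
proof (cases "S = {}")
  case True
  then show thesis by (intro that[of "\<lambda>_. 1"]) auto
next
  case False
  have "(min 1 (infdist x S) = 0) = (x \<in> closure S)" for x
    using in_closure_iff_infdist_zero[OF False, of x] by (simp add: min_def)
  then show thesis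
    by (intro that[of "\<lambda>x. min 1 (infdist x S)"] continuous_intros) (auto simp: infdist_nonneg)
qed

section \<open>From the small boundary property to uniform approximants\<close>

lemma frontier_UN_subset:
  "finite C \<Longrightarrow> frontier (\<Union>c\<in>C. V c) \<subseteq> (\<Union>c\<in>C. frontier (V c))"
proof (induction rule: finite_induct)
  case (insert a C)
  then show ?case
    using frontier_Un_subset[of "V a" "\<Union>c\<in>C. V c"] by auto
qed simp

text \<open>Finitely many null-boundary neighbourhoods inside \<open>U\<close> cover the compact set
  \<open>A\<close>, and the frontier of their union lies in the union of their frontiers.\<close>

lemma SBP_open_between:
  fixes \<Delta> :: "('a::metric_space) measure set"
  assumes comp: "compact (UNIV :: 'a set)" and \<Delta>: "\<Delta> \<subseteq> borel_probs" and SBP: "SBP \<Delta>"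
    and AU: "closed A" "open U" "A \<subseteq> U"
  obtains W where "open W" "A \<subseteq> W" "W \<subseteq> U" "\<And>\<mu>. \<mu> \<in> \<Delta> \<Longrightarrow> measure \<mu> (frontier W) = 0"
proof -
  have "\<exists>V. open V \<and> x \<in> V \<and> V \<subseteq> U \<and> (\<forall>\<mu>\<in>\<Delta>. measure \<mu> (frontier V) = 0)" if "x \<in> A" for x
    using SBP AU that unfolding SBP_def by blast
  then obtain V where V: "\<And>x. x \<in> A \<Longrightarrow> open (V x)" "\<And>x. x \<in> A \<Longrightarrow> x \<in> V x" "\<And>x. x \<in> A \<Longrightarrow> V x \<subseteq> U"
    "\<And>x \<mu>. x \<in> A \<Longrightarrow> \<mu> \<in> \<Delta> \<Longrightarrow> measure \<mu> (frontier (V x)) = 0"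
    by metis
  have "compact A"
    using compact_Int_closed[OF comp AU(1)] by simp
  then obtain C where C: "C \<subseteq> A" "finite C" "A \<subseteq> (\<Union>c\<in>C. V c)"
    by (rule compactE_image[of A A V]) (use V(1,2) in auto)
  show thesis
  proof
    show "open (\<Union>c\<in>C. V c)" "A \<subseteq> (\<Union>c\<in>C. V c)" "(\<Union>c\<in>C. V c) \<subseteq> U"
      using C V by blast+
    fix \<mu> assume \<mu>: "\<mu> \<in> \<Delta>"
    then have \<mu>b: "\<mu> \<in> borel_probs" using \<Delta> by blast
    interpret prob_space \<mu> using borel_probsD[OF \<mu>b] by simp
    have meas: "frontier T \<in> sets \<mu>" for T
      using borel_probsD(1)[OF \<mu>b] by (simp add: borel_closed)
    have "measure \<mu> (frontier (\<Union>c\<in>C. V c)) \<le> measure \<mu> (\<Union>c\<in>C. frontier (V c))"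
      using C(2) meas by (intro finite_measure_mono frontier_UN_subset sets.finite_UN)
    also have "\<dots> \<le> (\<Sum>c\<in>C. measure \<mu> (frontier (V c)))"
      using C(2) meas by (intro finite_measure_subadditive_finite) auto
    also have "\<dots> = 0"
      using C(1) V(4) \<mu> by (intro sum.neutral) auto
    finally show "measure \<mu> (frontier (\<Union>c\<in>C. V c)) = 0"
      by (simp add: measure_le_0_iff)
  qed
qed

lemma SBP_imp_uniform_approx:
  fixes \<Delta> :: "('a::metric_space) measure set" and f :: "'a \<Rightarrow> real"
  assumes comp: "compact (UNIV :: 'a set)" and \<Delta>: "\<Delta> \<subseteq> borel_probs" and SBP: "SBP \<Delta>"
    and f: "continuous_on UNIV f" and c: "c > 0"
  obtains g where "continuous_on UNIV g" "\<And>x. \<bar>f x - g x\<bar> \<le> 2 * c"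
    "\<And>\<mu>. \<mu> \<in> \<Delta> \<Longrightarrow> measure \<mu> (g -` {0}) = 0"
proof -
  have cl: "closed {x. f x \<le> 0}"
    by (intro closed_Collect_le f continuous_on_const)
  have op: "open {x. f x < c}"
    by (intro open_Collect_less f continuous_on_const)
  obtain W where W: "open W" "{x. f x \<le> 0} \<subseteq> W" "W \<subseteq> {x. f x < c}"
    "\<And>\<mu>. \<mu> \<in> \<Delta> \<Longrightarrow> measure \<mu> (frontier W) = 0"
    by (rule SBP_open_between[OF comp \<Delta> SBP cl op]) (use c in auto)
  obtain D :: "'a \<Rightarrow> real" where D: "continuous_on UNIV D" "\<And>x. 0 \<le> D x" "\<And>x. D x \<le> 1"
    "\<And>x. D x = 0 \<longleftrightarrow> x \<in> closure W"
    using distance_cutoff[of W] by metis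
  obtain E :: "'a \<Rightarrow> real" where E: "continuous_on UNIV E" "\<And>x. 0 \<le> E x" "\<And>x. E x \<le> 1"
    "\<And>x. E x = 0 \<longleftrightarrow> x \<in> closure (- W)"
    using distance_cutoff[of "- W"] by metis
  have cW: "closure (- W) = - W"
    using W(1) by (simp add: closure_complement interior_open)
  \<comment> \<open>The first two terms collapse the values of \<open>f\<close> in
    \<open>[0,c]\<close> to 0 at a cost of at most \<open>c\<close>. The last term, also of size at
    most \<open>c\<close>, then makes \<open>g\<close> negative on \<open>W\<close> and positive off
    its closure, so zeros remain only on the frontier.\<close>
  define g where "g x = min (f x) 0 + max (f x - c) 0 + c * (D x - E x)" for x
  have bd: "c * D x \<ge> 0" "c * D x \<le> c" "c * E x \<ge> 0" "c * E x \<le> c" for x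
    using c D(2,3)[of x] E(2,3)[of x] by (auto simp: mult_left_le)
  have g_in: "g x = min (f x) 0 - c * E x" "f x < c" if "x \<in> W" for x
    using W(3) that D(4)[of x] closure_subset[of W] by (auto simp: g_def max_def)
  have g_out: "g x = max (f x - c) 0 + c * D x" "f x > 0" if "x \<notin> W" for x
    using W(2) that E(4)[of x] cW by (auto simp: g_def min_def not_le[symmetric])
  have zero: "x \<in> frontier W" if "g x = 0" for x
  proof (cases "x \<in> W")
    case True
    then have "E x > 0"
      using E(2)[of x] E(4)[of x] cW by force
    then have "c * E x > 0"
      using c by simp
    then show ?thesis
      using g_in(1)[OF True] that min.cobounded2[of "f x" 0] by linarith
  next
    case False
    then have "c * D x = 0"
      using g_out[OF False] bd(1)[of x] that by (auto simp: max_def split: if_splits)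
    then show ?thesis
      using D(4)[of x] c W(1) False by (simp add: frontier_def interior_open)
  qed
  show thesis
  proof
    show gc: "continuous_on UNIV g"
      unfolding g_def by (intro continuous_intros f D E)
    show "\<bar>f x - g x\<bar> \<le> 2 * c" for x
    proof (cases "x \<in> W")
      case True
      then show ?thesis
        using g_in[of x] bd(3,4)[of x] c by linarith
    next
      case False
      then show ?thesis
        using g_out[of x] bd(1,2)[of x] c by linarith
    qed
    fix \<mu> assume \<mu>: "\<mu> \<in> \<Delta>"
    then have \<mu>b: "\<mu> \<in> borel_probs" using \<Delta> by blast
    interpret prob_space \<mu> using borel_probsD[OF \<mu>b] by simp
    have "measure \<mu> (g -` {0}) \<le> measure \<mu> (frontier W)"
      using zero borel_probsD(1)[OF \<mu>b] by (intro finite_measure_mono) (auto simp: borel_closed)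
    then show "measure \<mu> (g -` {0}) = 0"
      using W(4)[OF \<mu>] by (simp add: measure_le_0_iff)
  qed
qed

section \<open>The norm over \<Delta> against the uniform norm and Chebyshev's inequality\<close>

lemma norm2_Delta_le:
  fixes \<Delta> :: "('a::metric_space) measure set"
  assumes comp: "compact (UNIV :: 'a set)" and \<Delta>: "\<Delta> \<subseteq> borel_probs"
    and h: "continuous_on UNIV h" "\<And>x. \<bar>h x\<bar> \<le> c"
  shows "norm2_Delta \<Delta> h \<le> ennreal c"
  unfolding norm2_Delta_def
proof (intro SUP_least ennreal_leI)
  fix \<mu> assume "\<mu> \<in> \<Delta>"
  then have \<mu>: "\<mu> \<in> borel_probs" using \<Delta> by blast
  interpret prob_space \<mu> using borel_probsD[OF \<mu>] by simp
  have c: "c \<ge> 0" using h(2)[of undefined] by linarith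
  have "(\<integral>x. \<bar>h x\<bar>\<^sup>2 \<partial>\<mu>) \<le> (\<integral>x. c\<^sup>2 \<partial>\<mu>)"
  proof (rule integral_mono)
    show "integrable \<mu> (\<lambda>x. \<bar>h x\<bar>\<^sup>2)"
      by (intro continuous_integrable[OF comp \<mu>] continuous_intros h)
    show "\<bar>h x\<bar>\<^sup>2 \<le> c\<^sup>2" for x
      using h(2) by (intro power_mono) auto
  qed simp
  then show "sqrt (\<integral>x. \<bar>h x\<bar>\<^sup>2 \<partial>\<mu>) \<le> c"
    using c by (simp add: real_le_lsqrt prob_space)
qed

text \<open>Chebyshev's inequality for the square of \<open>h\<close>; the bound is the same for
  every \<mu> in \<Delta> because the norm is a supremum.\<close>

lemma measure_ge_le_norm2:
  fixes \<Delta> :: "('a::metric_space) measure set"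
  assumes comp: "compact (UNIV :: 'a set)" and \<mu>: "\<mu> \<in> \<Delta>" "\<mu> \<in> borel_probs"
    and h: "continuous_on UNIV h" and small: "norm2_Delta \<Delta> h < ennreal e" and c: "c > 0"
  shows "measure \<mu> {x. c \<le> \<bar>h x\<bar>} \<le> (e / c)\<^sup>2"
proof -
  interpret prob_space \<mu> using borel_probsD[OF \<mu>(2)] by simp
  have int: "integrable \<mu> (\<lambda>x. \<bar>h x\<bar>\<^sup>2)"
    by (intro continuous_integrable[OF comp \<mu>(2)] continuous_intros h)
  \<comment> \<open>\<open>ennreal\<close> sends nonpositive reals to 0, and nothing lies strictly
    below 0.\<close>
  have e: "e > 0"
    using small by (metis ennreal_neg not_le not_less_zero)
  have "ennreal (sqrt (\<integral>x. \<bar>h x\<bar>\<^sup>2 \<partial>\<mu>)) \<le> norm2_Delta \<Delta> h"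
    unfolding norm2_Delta_def using \<mu>(1) by (intro SUP_upper)
  then have "sqrt (\<integral>x. \<bar>h x\<bar>\<^sup>2 \<partial>\<mu>) \<le> e"
    using small e by (metis ennreal_le_iff less_imp_le order_le_less_trans)
  then have le: "(\<integral>x. \<bar>h x\<bar>\<^sup>2 \<partial>\<mu>) \<le> e\<^sup>2"
    by (rule sqrt_le_D)
  have "closed {x. c \<le> \<bar>h x\<bar>}"
    by (intro closed_Collect_le continuous_intros h)
  then have meas: "{x. c \<le> \<bar>h x\<bar>} \<in> sets \<mu>"
    using borel_probsD(1)[OF \<mu>(2)] by (simp add: borel_closed)
  have "(\<integral>x. c\<^sup>2 * indicator {x. c \<le> \<bar>h x\<bar>} x \<partial>\<mu>) \<le> (\<integral>x. \<bar>h x\<bar>\<^sup>2 \<partial>\<mu>)"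
  proof (rule integral_mono[OF _ int])
    show "integrable \<mu> (\<lambda>x. c\<^sup>2 * indicator {x. c \<le> \<bar>h x\<bar>} x)"
      using meas by (intro integrable_mult_right) (simp add: emeasure_eq_measure)
    show "c\<^sup>2 * indicator {x. c \<le> \<bar>h x\<bar>} x \<le> \<bar>h x\<bar>\<^sup>2" for x
      using c power_mono[of c "\<bar>h x\<bar>" 2] by (auto simp: indicator_def)
  qed
  then have "c\<^sup>2 * measure \<mu> {x. c \<le> \<bar>h x\<bar>} \<le> e\<^sup>2"
    using le borel_probsD(3)[OF \<mu>(2)] by simp
  then show ?thesis
    using c by (simp add: power_divide field_simps)
qed

section \<open>From approximation in the norm over \<Delta> to null boundaries\<close>

definition L2_approximable :: "('a::topological_space) measure set \<Rightarrow> bool" where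
  "L2_approximable \<Delta> \<longleftrightarrow> (\<forall>f \<epsilon>. continuous_on UNIV f \<and> \<epsilon> > 0 \<longrightarrow>
     (\<exists>g. continuous_on UNIV g \<and> norm2_Delta \<Delta> (\<lambda>x. f x - g x) < ennreal \<epsilon> \<and>
          (\<forall>\<mu>\<in>\<Delta>. measure \<mu> (g -` {0}) < \<epsilon>)))"

text \<open>Clamping \<open>g\<close> to \<open>[f - c, f + c]\<close> enforces the uniform bound.
  It alters \<open>g\<close> only where \<open>g\<close> is at least \<open>c\<close> away from
  \<open>f\<close>, a set that Chebyshev makes small for all of \<Delta> at once.\<close>

lemma L2_approximable_imp_uniform:
  fixes \<Delta> :: "('a::metric_space) measure set" and f :: "'a \<Rightarrow> real"
  assumes comp: "compact (UNIV :: 'a set)" and \<Delta>: "\<Delta> \<subseteq> borel_probs"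
    and appr: "L2_approximable \<Delta>"
    and f: "continuous_on UNIV f" and c: "c > 0" and e: "e > 0"
  obtains g where "continuous_on UNIV g" "\<And>x. \<bar>f x - g x\<bar> \<le> c"
    "\<And>\<mu>. \<mu> \<in> \<Delta> \<Longrightarrow> measure \<mu> (g -` {0}) < e"
proof -
  \<comment> \<open>The first entry pays for the zeros of \<open>g\<close>, the second makes the
    Chebyshev bound \<open>(d / c)\<^sup>2\<close> at most \<open>e / 2\<close>.\<close>
  define d where "d = min (e / 2) (c * sqrt (e / 2))"
  have d: "d > 0" "d \<le> e / 2"
    using c e by (auto simp: d_def)
  have "d / c \<le> sqrt (e / 2)"
    using c by (simp add: d_def divide_le_eq mult.commute)
  then have dc: "(d / c)\<^sup>2 \<le> e / 2"
    using power_mono[of "d / c" "sqrt (e / 2)" 2] d(1) c e by simp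
  obtain g where g: "continuous_on UNIV g" "norm2_Delta \<Delta> (\<lambda>x. f x - g x) < ennreal d"
    "\<And>\<mu>. \<mu> \<in> \<Delta> \<Longrightarrow> measure \<mu> (g -` {0}) < d"
    using appr f d(1) unfolding L2_approximable_def by metis
  define k where "k x = max (f x - c) (min (f x + c) (g x))" for x
  have kc: "continuous_on UNIV k"
    unfolding k_def by (intro continuous_intros f g)
  show thesis
  proof
    show "continuous_on UNIV k" by fact
    show "\<bar>f x - k x\<bar> \<le> c" for x
      using c by (auto simp: k_def min_def max_def)
    fix \<mu> assume \<mu>: "\<mu> \<in> \<Delta>"
    then have \<mu>b: "\<mu> \<in> borel_probs" using \<Delta> by blast
    interpret prob_space \<mu> using borel_probsD[OF \<mu>b] by simp
    have hc: "continuous_on UNIV (\<lambda>x. f x - g x)"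
      by (intro continuous_intros f g)
    have "closed {x. c \<le> \<bar>f x - g x\<bar>}"
      by (intro closed_Collect_le continuous_intros f g)
    then have meas: "{x. c \<le> \<bar>f x - g x\<bar>} \<in> sets \<mu>" "g -` {0} \<in> sets \<mu>"
      using borel_probsD(1)[OF \<mu>b] zero_set_measurable[OF \<mu>b g(1)] by (simp_all add: borel_closed)
    have "k -` {0} \<subseteq> g -` {0} \<union> {x. c \<le> \<bar>f x - g x\<bar>}"
      by (auto simp: k_def min_def max_def split: if_splits)
    then have "measure \<mu> (k -` {0}) \<le> measure \<mu> (g -` {0} \<union> {x. c \<le> \<bar>f x - g x\<bar>})"
      using meas by (intro finite_measure_mono) auto
    also have "\<dots> \<le> measure \<mu> (g -` {0}) + measure \<mu> {x. c \<le> \<bar>f x - g x\<bar>}"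
      using meas by (intro measure_Un_le) 
    also have "\<dots> < d + (d / c)\<^sup>2"
      using g(3)[OF \<mu>] measure_ge_le_norm2[OF comp \<mu> \<mu>b hc g(2) c] by linarith
    finally show "measure \<mu> (k -` {0}) < e"
      using d(2) dc by linarith
  qed
qed

text \<open>Baire's theorem in the Banach space of bounded continuous functions: the sets
  \<open>G n\<close> are open by the cutoff criterion and dense by uniform approximation, and a
  member of all of them has a null zero set for every \<mu> in \<Delta>.\<close>

lemma L2_approximable_imp_null_zero_set:
  fixes \<Delta> :: "('a::metric_space) measure set" and f :: "'a \<Rightarrow> real"
  assumes comp: "compact (UNIV :: 'a set)" and cl: "closedin weak_star_topology \<Delta>"
    and appr: "L2_approximable \<Delta>"
    and f: "continuous_on UNIV f" and c: "c > 0"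
  obtains g where "continuous_on UNIV g" "\<And>x. \<bar>f x - g x\<bar> \<le> c"
    "\<And>\<mu>. \<mu> \<in> \<Delta> \<Longrightarrow> measure \<mu> (g -` {0}) = 0"
proof -
  have \<Delta>: "\<Delta> \<subseteq> borel_probs"
    using closedin_subset[OF cl] topspace_weak_star by metis
  \<comment> \<open>By compactness this space contains every continuous function, and its metric is
    the uniform one.\<close>
  have bcont: "\<exists>F :: 'a \<Rightarrow>\<^sub>C real. apply_bcontfun F = h" if h: "continuous_on UNIV h" for h
  proof -
    obtain B where "\<And>x. \<bar>h x\<bar> \<le> B"
      using continuous_bounded_on_compact_UNIV[OF comp h] by metis
    then have "h \<in> bcontfun"
      using h by (intro bcontfun_normI[of _ B]) auto
    then show ?thesis
      using Bcontfun_inverse by blast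
  qed
  define G where "G n = {F :: 'a \<Rightarrow>\<^sub>C real. \<forall>\<mu>\<in>\<Delta>. measure \<mu> (apply_bcontfun F -` {0}) < 1 / Suc n}" for n
  have "open (G n)" for n
    unfolding open_contains_ball
  proof
    fix F assume "F \<in> G n"
    then obtain \<delta> where \<delta>: "\<delta> > 0" "\<And>\<mu>. \<mu> \<in> \<Delta> \<Longrightarrow> (\<integral>x. chi \<delta> (apply_bcontfun F x) \<partial>\<mu>) < 1 / Suc n"
      using zero_sets_small_iff_chi[OF comp cl continuous_on_apply_bcontfun, of F "1 / Suc n"]
      unfolding G_def by blast
    \<comment> \<open>A zero of \<open>H\<close> is a point where \<open>F\<close> is at most
      \<open>\<delta> / 2\<close> in absolute value, so the cutoff of \<open>F\<close> equals 1
      there.\<close>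
    have "H \<in> G n" if H: "H \<in> ball F (\<delta> / 2)" for H
      unfolding G_def
    proof (intro CollectI ballI)
      fix \<mu> assume \<mu>: "\<mu> \<in> \<Delta>"
      then have \<mu>b: "\<mu> \<in> borel_probs" using \<Delta> by blast
      have "measure \<mu> (apply_bcontfun H -` {0}) \<le> (\<integral>x. chi \<delta> (apply_bcontfun F x) \<partial>\<mu>)"
      proof (rule measure_le_integral_chi[OF comp \<mu>b continuous_on_apply_bcontfun \<delta>(1)])
        show "apply_bcontfun H -` {0} \<in> sets \<mu>"
          by (rule zero_set_measurable[OF \<mu>b continuous_on_apply_bcontfun])
        fix x assume "x \<in> apply_bcontfun H -` {0}"
        then show "\<bar>apply_bcontfun F x\<bar> \<le> \<delta> / 2"
          using dist_bounded[of F x H] H by (simp add: dist_real_def)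
      qed
      then show "measure \<mu> (apply_bcontfun H -` {0}) < 1 / Suc n"
        using \<delta>(2)[OF \<mu>] by linarith
    qed
    then show "\<exists>e>0. ball F e \<subseteq> G n"
      using \<delta>(1) by (intro exI[of _ "\<delta> / 2"]) auto
  qed
  moreover have "closure (G n) = UNIV" for n
  proof -
    have "F \<in> closure (G n)" for F
      unfolding closure_approachable
    proof (intro allI impI)
      \<comment> \<open>Approximation to within \<open>r / 2\<close> yields the strict inequality
        for \<open>r\<close>.\<close>
      fix r :: real assume "r > 0"
      obtain g where g: "continuous_on UNIV g" "\<And>x. \<bar>apply_bcontfun F x - g x\<bar> \<le> r / 2"
        "\<And>\<mu>. \<mu> \<in> \<Delta> \<Longrightarrow> measure \<mu> (g -` {0}) < 1 / Suc n"
        using L2_approximable_imp_uniform[OF comp \<Delta> appr continuous_on_apply_bcontfun[of UNIV F], of "r / 2" "1 / Suc n"]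
          \<open>r > 0\<close> by (metis half_gt_zero of_nat_0_less_iff zero_less_Suc zero_less_divide_1_iff)
      obtain H where H: "apply_bcontfun H = g"
        using bcont[OF g(1)] by blast
      have "dist H F \<le> r / 2"
        using g(2) by (intro dist_bound) (simp add: H dist_real_def abs_minus_commute)
      then show "\<exists>H\<in>G n. dist H F < r"
        using g(3) H \<open>r > 0\<close> by (intro bexI[of _ H]) (auto simp: G_def)
    qed
    then show ?thesis by blast
  qed
  ultimately have "euclidean closure_of (\<Inter>(range G)) = topspace (euclidean :: ('a \<Rightarrow>\<^sub>C real) topology)"
    by (intro Baire_category) (auto simp: completely_metrizable_space_euclidean euclidean_closure_of)
  then have dense: "closure (\<Inter>(range G)) = UNIV"
    by (simp add: euclidean_closure_of)
  obtain F where F: "apply_bcontfun F = f"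
    using bcont[OF f] by blast
  have "F \<in> closure (\<Inter>(range G))"
    using dense by simp
  then obtain H where H: "H \<in> \<Inter>(range G)" "dist H F < c"
    using c unfolding closure_approachable by blast
  show thesis
  proof
    show "continuous_on UNIV (apply_bcontfun H)"
      by (rule continuous_on_apply_bcontfun)
    show "\<bar>f x - apply_bcontfun H x\<bar> \<le> c" for x
      using dist_bounded[of H x F] H(2) F by (simp add: dist_real_def)
    fix \<mu> assume \<mu>: "\<mu> \<in> \<Delta>"
    have "measure \<mu> (apply_bcontfun H -` {0}) < 1 / Suc n" for n
      using H(1) \<mu> by (auto simp: G_def)
    then have "\<not> measure \<mu> (apply_bcontfun H -` {0}) > 0"
      by (metis nat_approx_posE not_less_iff_gr_or_eq order_less_trans)
    then show "measure \<mu> (apply_bcontfun H -` {0}) = 0"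
      by (simp add: zero_less_measure_iff)
  qed
qed

text \<open>A function positive at \<open>x\<close> and negative off \<open>U\<close> is perturbed
  to have a null zero set. The perturbed function \<open>g\<close> still has these signs, and the
  frontier of the set where it is positive consists of zeros.\<close>

lemma L2_approximable_imp_SBP:
  fixes \<Delta> :: "('a::metric_space) measure set"
  assumes comp: "compact (UNIV :: 'a set)" and cl: "closedin weak_star_topology \<Delta>"
    and appr: "L2_approximable \<Delta>"
  shows "SBP \<Delta>"
  unfolding SBP_def
proof (intro allI impI)
  fix x :: 'a and U assume U: "open U \<and> x \<in> U"
  obtain D :: "'a \<Rightarrow> real" where D: "continuous_on UNIV D" "\<And>x. 0 \<le> D x" "\<And>x. D x = 0 \<longleftrightarrow> x \<in> closure (- U)"
    using distance_cutoff[of "- U"] by metis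
  have cU: "closure (- U) = - U"
    using U by (simp add: closure_complement interior_open)
  define a where "a = D x"
  have a: "a > 0"
    using D(2)[of x] D(3)[of x] cU U by (auto simp: a_def)
  \<comment> \<open>This function is \<open>a / 2\<close> at \<open>x\<close> and
    \<open>- a / 2\<close> off \<open>U\<close>, so an error of \<open>a / 4\<close> preserves both
    signs.\<close>
  have fc: "continuous_on UNIV (\<lambda>y. D y - a / 2)"
    by (intro continuous_intros D)
  obtain g where g: "continuous_on UNIV g" "\<And>y. \<bar>(D y - a / 2) - g y\<bar> \<le> a / 4"
    "\<And>\<mu>. \<mu> \<in> \<Delta> \<Longrightarrow> measure \<mu> (g -` {0}) = 0"
    by (rule L2_approximable_imp_null_zero_set[OF comp cl appr fc, of "a / 4"]) (use a in auto)
  define V where "V = {y. g y > 0}"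
  have opV: "open V"
    unfolding V_def by (intro open_Collect_less g continuous_on_const)
  have "closed {y. g y \<ge> 0}"
    by (intro closed_Collect_le g continuous_on_const)
  then have "closure V \<subseteq> {y. g y \<ge> 0}"
    by (intro closure_minimal) (auto simp: V_def)
  then have fr: "frontier V \<subseteq> g -` {0}"
    using opV by (auto simp: frontier_def interior_open V_def)
  have "measure \<mu> (frontier V) = 0" if \<mu>: "\<mu> \<in> \<Delta>" for \<mu>
  proof -
    have \<mu>b: "\<mu> \<in> borel_probs"
      using \<mu> closedin_subset[OF cl] topspace_weak_star by blast
    interpret prob_space \<mu> using borel_probsD[OF \<mu>b] by simp
    have "measure \<mu> (frontier V) \<le> measure \<mu> (g -` {0})"
      using fr zero_set_measurable[OF \<mu>b g(1)] by (intro finite_measure_mono)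
    then show ?thesis
      using g(3)[OF \<mu>] by (simp add: measure_le_0_iff)
  qed
  moreover have "x \<in> V"
    using g(2)[of x] a unfolding V_def a_def mem_Collect_eq by linarith
  moreover have "V \<subseteq> U"
  proof
    fix y assume "y \<in> V"
    then have "D y \<noteq> 0"
      using g(2)[of y] a unfolding V_def mem_Collect_eq by linarith
    then show "y \<in> U"
      using D(3)[of y] cU by simp
  qed
  ultimately show "\<exists>V. open V \<and> x \<in> V \<and> V \<subseteq> U \<and> (\<forall>\<mu>\<in>\<Delta>. measure \<mu> (frontier V) = 0)"
    using opV by blast
qed

section \<open>The converse direction and the equivalence\<close>

lemma SBP_imp_L2_approximable:
  fixes \<Delta> :: "('a::metric_space) measure set"
  assumes comp: "compact (UNIV :: 'a set)" and \<Delta>: "\<Delta> \<subseteq> borel_probs" and SBP: "SBP \<Delta>"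
  shows "L2_approximable \<Delta>"
  unfolding L2_approximable_def
proof (intro allI impI)
  fix f :: "'a \<Rightarrow> real" and \<epsilon> :: real
  assume f: "continuous_on UNIV f \<and> \<epsilon> > 0"
  obtain g where g: "continuous_on UNIV g" "\<And>x. \<bar>f x - g x\<bar> \<le> 2 * (\<epsilon> / 4)"
    "\<And>\<mu>. \<mu> \<in> \<Delta> \<Longrightarrow> measure \<mu> (g -` {0}) = 0"
    \<comment> \<open>The uniform error is twice the parameter, so \<open>\<epsilon> / 4\<close>
      bounds the supremum by \<open>\<epsilon> / 2\<close>, strictly below \<epsilon>.\<close>
    by (rule SBP_imp_uniform_approx[OF comp \<Delta> SBP, of f "\<epsilon> / 4"]) (use f in auto)
  have "norm2_Delta \<Delta> (\<lambda>x. f x - g x) \<le> ennreal (2 * (\<epsilon> / 4))"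
    using f g by (intro norm2_Delta_le[OF comp \<Delta>] continuous_intros) auto
  also have "\<dots> < ennreal \<epsilon>"
    using f by (intro ennreal_lessI) auto
  finally show "\<exists>g. continuous_on UNIV g \<and> norm2_Delta \<Delta> (\<lambda>x. f x - g x) < ennreal \<epsilon> \<and>
      (\<forall>\<mu>\<in>\<Delta>. measure \<mu> (g -` {0}) < \<epsilon>)"
    using f g by auto
qed

theorem theorem2p9:
  fixes \<Delta> :: "('a::metric_space) measure set"
  assumes "compact (UNIV :: 'a set)"
    and "closedin weak_star_topology \<Delta>"
  shows "(SBP \<Delta> \<longleftrightarrow>
           (\<forall>f \<epsilon>. continuous_on UNIV f \<and> \<epsilon> > 0 \<longrightarrow>
              (\<exists>g. continuous_on UNIV g \<and>
                   norm2_Delta \<Delta> (\<lambda>x. f x - g x) < ennreal \<epsilon> \<and>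
                   (\<forall>\<mu>\<in>\<Delta>. measure \<mu> (g -` {0}) < \<epsilon>))))
       \<and> (\<forall>(g :: 'a \<Rightarrow> real) \<epsilon>. continuous_on UNIV g \<and> \<epsilon> > 0 \<longrightarrow>
            ((\<forall>\<mu>\<in>\<Delta>. measure \<mu> (g -` {0}) < \<epsilon>) \<longleftrightarrow>
             (\<exists>\<delta>>0. \<forall>\<mu>\<in>\<Delta>. (\<integral>x. chi \<delta> (g x) \<partial>\<mu>) < \<epsilon>)))"
proof -
  have \<Delta>: "\<Delta> \<subseteq> borel_probs"
    using closedin_subset[OF assms(2)] topspace_weak_star by metis
  have "SBP \<Delta> \<longleftrightarrow> L2_approximable \<Delta>"
    using SBP_imp_L2_approximable[OF assms(1) \<Delta>] L2_approximable_imp_SBP[OF assms] by blast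
  then show ?thesis
    unfolding L2_approximable_def using zero_sets_small_iff_chi[OF assms] by blast
qed

end
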